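(* Let $\mathcal{D}_n$ be the set of all Dyck paths of semilength $n$. For $d\in\mathcal{D}_n$, let $w(d)=w(d)_1w(d)_2\cdots w(d)_{|w(d)|}$ be the word of positive integers consisting of the lengths of the maximal consecutive strings of north steps of $d$, listed in the order they occur along $d$, where $|w(d)|$ is the number of such strings. Then for every integer $n\ge 1$, $$\mathrm{pf}_n(312,321)=\sum_{d\in\mathcal{D}_n}\ \prod_{i=1}^{|w(d)|-1}\bigl(w(d)_i+1\bigr),$$ where an empty product equals $1$.
   Context: A Dyck path of semilength $n$ is a lattice path from $(0,0)$ to $(n,n)$ consisting of $n$ north steps $N=(0,1)$ and $n$ east steps $E=(1,0)$ that never goes below the line $y=x$. A parking function of size $n$ is a Dyck path of semilength $n$ whose $n$ north steps are labeled bijectively by $\{1,\dots,n\}$ so that whenever two north steps are consecutive in the path (one immediately following the other), the label of the later one is larger. For a parking function $p$ of size $n$, $\phi(p)$ is the permutation of $\{1,\dots,n\}$ (in one-line notation) obtained by reading the labels of the north steps in the order they occur along the path. A permutation $\pi$ of $\{1,\dots,n\}$ contains a permutation $\rho$ of $\{1,\dots,m\}$ if there are indices $1\le i_1<\cdots<i_m\le n$ such that $\pi_{i_a}\le\pi_{i_b}$ if and only if $\rho_a\le\rho_b$; otherwise $\pi$ avoids $\rho$. For permutations $\rho_1,\dots,\rho_r$, $\mathrm{pf}_n(\rho_1,\dots,\rho_r)$ denotes the number of parking functions $p$ of size $n$ such that $\phi(p)$ avoids each of $\rho_1,\dots,\rho_r$. *)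

theory Defs
  imports Main "HOL-Library.FuncSet"
begin

datatype step = North | East

text \<open>
  A lattice path starting at the origin is the list of its steps. After \<open>k\<close> steps it is at the point
  with \<open>x\<close>-coordinate \<open>count_list (take k d) East\<close> and \<open>y\<close>-coordinate
  \<open>count_list (take k d) North\<close>; it stays weakly above the diagonal iff all these points do.
\<close>

definition dyck_paths :: "nat \<Rightarrow> step list set" where
  "dyck_paths n =
     {d. count_list d North = n \<and> count_list d East = n \<and>
         (\<forall>k\<le>length d. count_list (take k d) East \<le> count_list (take k d) North)}"

definition north_positions :: "step list \<Rightarrow> nat set" where
  "north_positions d = {i. i < length d \<and> d ! i = North}"

text \<open>
  A parking function is a Dyck path with a labelling of its north steps, each step being identified
  by its position (from 0) in the path. The labelling is \<open>undefined\<close> at all other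
  positions, so that every parking function is represented by exactly one pair.
\<close>

definition parking_functions :: "nat \<Rightarrow> (step list \<times> (nat \<Rightarrow> nat)) set" where
  "parking_functions n =
     {(d, l). d \<in> dyck_paths n \<and>
        l \<in> extensional (north_positions d) \<and>
        bij_betw l (north_positions d) {1..n} \<and>
        (\<forall>i. i \<in> north_positions d \<and> Suc i \<in> north_positions d \<longrightarrow> l i < l (Suc i))}"

text \<open>Permutations are given in one-line notation, as lists.\<close>

definition parking_perm :: "step list \<times> (nat \<Rightarrow> nat) \<Rightarrow> nat list" where
  "parking_perm p = (case p of (d, l) \<Rightarrow> map l (filter (\<lambda>i. d ! i = North) [0..<length d]))"

definition contains_pattern :: "nat list \<Rightarrow> nat list \<Rightarrow> bool" where
  "contains_pattern \<pi> \<rho> \<longleftrightarrow>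
     (\<exists>f. strict_mono_on {..<length \<rho>} f \<and> f ` {..<length \<rho>} \<subseteq> {..<length \<pi>} \<and>
        (\<forall>a<length \<rho>. \<forall>b<length \<rho>. \<pi> ! f a \<le> \<pi> ! f b \<longleftrightarrow> \<rho> ! a \<le> \<rho> ! b))"

definition pf :: "nat \<Rightarrow> nat list set \<Rightarrow> nat" where
  "pf n R = card {p \<in> parking_functions n. \<forall>\<rho>\<in>R. \<not> contains_pattern (parking_perm p) \<rho>}"

text \<open>The lengths of the maximal runs of north steps, in order of occurrence.\<close>

function north_runs :: "step list \<Rightarrow> nat list" where
  "north_runs [] = []"
| "north_runs (East # d) = north_runs d"
| "north_runs (North # d) =
     Suc (length (takeWhile (\<lambda>s. s = North) d)) # north_runs (dropWhile (\<lambda>s. s = North) d)"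
  by pat_completeness auto
termination
  by (relation "measure length") (auto simp: le_imp_less_Suc length_dropWhile_le)

lemma finite_dyck_paths: "finite (dyck_paths n)"
proof (rule finite_subset)
  have "length d = count_list d North + count_list d East" for d
  proof (induction d)
    case (Cons s d)
    then show ?case by (cases s) auto
  qed simp
  then show "dyck_paths n \<subseteq> {d. set d \<subseteq> {North, East} \<and> length d = 2 * n}"
    by (auto simp: dyck_paths_def) (metis step.exhaust)
  show "finite {d. set d \<subseteq> {North, East} \<and> length d = 2 * n}"
    by (rule finite_lists_length_eq) simp
qed

lemma finite_parking_functions: "finite (parking_functions n)"
proof (rule finite_subset)
  show "parking_functions n \<subseteq>
      (SIGMA d:dyck_paths n. north_positions d \<rightarrow>\<^sub>E {1..n})"
    by (auto simp: parking_functions_def PiE_def bij_betw_def Pi_def)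
  show "finite (SIGMA d:dyck_paths n. north_positions d \<rightarrow>\<^sub>E {1..n})"
    by (intro finite_SigmaI finite_dyck_paths finite_PiE) (auto simp: north_positions_def)
qed

end

theory Submission
  imports Defs
begin

text \<open>
  A permutation avoids 312 and 321 iff every entry is the smallest or the second smallest among
  itself and the entries to its right. It is thus encoded by a 0/1 word recording which of the two
  occurs (the last letter being 0), and it has a descent exactly where a 1 is followed by a 0.
  Being increasing along a north run of length \<open>w\<close> means that the letters of the run form a word
  \<open>0\<^sup>a1\<^sup>b\<close> with \<open>a + b = w\<close>: there are \<open>w + 1\<close> choices, except for the last run, which is all 0.
\<close>

section \<open>Avoiding labellings of a path, encoded as lists of labels\<close>

text \<open>The recursion tests only the first entry, so that the counting below can remove one
  label at a time. The link to patterns is made by \<open>avoiding_iff\<close> and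
  \<open>avoids_312_321_iff\<close>.\<close>

fun avoiding :: "nat list \<Rightarrow> bool" where
  "avoiding [] \<longleftrightarrow> True"
| "avoiding (x # xs) \<longleftrightarrow> card {y \<in> set xs. y < x} \<le> 1 \<and> avoiding xs"

text \<open>Each north step consumes one label, so the predicate also fixes the number of labels.
  Labels are compared only when the very next step is north, that is, within a run.\<close>

fun increasing_along :: "step list \<Rightarrow> nat list \<Rightarrow> bool" where
  "increasing_along [] xs \<longleftrightarrow> xs = []"
| "increasing_along (East # d) xs \<longleftrightarrow> increasing_along d xs"
| "increasing_along (North # d) [] \<longleftrightarrow> False"
| "increasing_along (North # d) (x # xs) \<longleftrightarrow>
     increasing_along d xs \<and> (d \<noteq> [] \<and> hd d = North \<longrightarrow> x < hd xs)"

text \<open>The label set is arbitrary instead of \<open>{1..n}\<close> because removing the first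
  label leaves a set with a gap.\<close>

definition labellings :: "step list \<Rightarrow> nat set \<Rightarrow> nat list set" where
  "labellings d S = {xs. distinct xs \<and> set xs = S \<and> increasing_along d xs \<and> avoiding xs}"

text \<open>This is the product of the theorem in recursive form: the second equation gives the last
  run the factor 1.\<close>

fun run_weight :: "nat list \<Rightarrow> nat" where
  "run_weight [] = 1"
| "run_weight [w] = 1"
| "run_weight (w # v # ws) = (w + 1) * run_weight (v # ws)"

lemma run_weight_eq_prod: "run_weight ws = (\<Prod>i<length ws - 1. (ws ! i + 1))"
proof (induction ws rule: run_weight.induct)
  case (3 w v ws)
  then show ?case by (simp add: prod.lessThan_Suc_shift del: prod.lessThan_Suc)
qed simp_all

lemma run_weight_Cons: "ws \<noteq> [] \<Longrightarrow> run_weight (w # ws) = (w + 1) * run_weight ws"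
  by (cases ws) simp_all

lemma finite_labellings: "finite S \<Longrightarrow> finite (labellings d S)"
  by (rule finite_subset[OF _ finite_subset_distinct[of S]]) (auto simp: labellings_def)

lemma length_increasing_along: "increasing_along d xs \<Longrightarrow> length xs = count_list d North"
  by (induction d xs rule: increasing_along.induct) auto

text \<open>Guarantees that \<open>hd xs\<close> is an actual label whenever the path continues with
  a north step.\<close>

lemma increasing_along_nonempty:
  assumes "increasing_along d xs" "d \<noteq> []" "hd d = North"
  shows "xs \<noteq> []"
proof -
  from assms obtain d' where "d = North # d'" by (cases d) auto
  with assms(1) show ?thesis by (cases xs) auto
qed

lemma north_runs_eq_Nil_iff: "north_runs d = [] \<longleftrightarrow> count_list d North = 0"
  by (induction d rule: north_runs.induct) auto

section \<open>Counting the labellings of a fixed path\<close>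

text \<open>If the first label is the minimum (letter 0), both conditions at the first position hold
  automatically, so removing it is a bijection onto the labellings of \<open>d\<close> by the other
  labels. The second summand counts those with first letter 1.\<close>

lemma labellings_North_split:
  assumes "finite S" "S \<noteq> {}"
  shows "card (labellings (North # d) S) =
    card (labellings d (S - {Min S})) + card {xs \<in> labellings (North # d) S. hd xs \<noteq> Min S}"
proof -
  define m where "m = Min S"
  have m: "m \<in> S" "\<And>y. y \<in> S \<Longrightarrow> m \<le> y" using assms by (auto simp: m_def)
  have eq: "{xs \<in> labellings (North # d) S. hd xs = m} = Cons m ` labellings d (S - {m})"
    (is "?L = ?R")
  proof
    show "?L \<subseteq> ?R"
    proof
      fix xs assume "xs \<in> ?L"
      then obtain ys where "xs = m # ys" "ys \<in> labellings d (S - {m})"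
        by (cases xs) (auto simp: labellings_def)
      then show "xs \<in> ?R" by blast
    qed
    show "?R \<subseteq> ?L"
    proof
      fix xs assume "xs \<in> ?R"
      then obtain ys where xs: "xs = m # ys" and ys: "ys \<in> labellings d (S - {m})" by blast
      have "{y \<in> set ys. y < m} = {}"
        using ys m(2) by (fastforce simp: labellings_def)
      then have none: "card {y \<in> set ys. y < m} \<le> 1" by (simp only: card.empty)
      have "m < hd ys" if "d \<noteq> []" "hd d = North"
      proof -
        have "ys \<noteq> []" "set ys = S - {m}"
          using ys that increasing_along_nonempty by (auto simp: labellings_def)
        then have "hd ys \<in> S - {m}" using hd_in_set by blast
        then show ?thesis using m(2)[of "hd ys"] by auto
      qed
      with none ys m(1) show "xs \<in> ?L" by (auto simp: xs labellings_def)
    qed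
  qed
  have "labellings (North # d) S = {xs \<in> labellings (North # d) S. hd xs = m} \<union>
      {xs \<in> labellings (North # d) S. hd xs \<noteq> m}" by blast
  then have "card (labellings (North # d) S) =
      card {xs \<in> labellings (North # d) S. hd xs = m} +
      card {xs \<in> labellings (North # d) S. hd xs \<noteq> m}"
    using finite_labellings[OF assms(1), of "North # d"]
    by (metis (no_types, lifting) card_Un_disjoint disjoint_iff finite_Un mem_Collect_eq)
  also have "card {xs \<in> labellings (North # d) S. hd xs = m} = card (labellings d (S - {m}))"
    unfolding eq by (rule card_image) simp
  finally show ?thesis by (simp add: m_def)
qed

text \<open>A first label that is not the minimum must be the second smallest element
  \<open>s\<close>. If the run continues, the next label exceeds \<open>s\<close> iff it is not the
  minimum either, so a letter 1 forces another 1 within the run. If the run ends, the remaining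
  labelling is unrestricted.\<close>

lemma card_labellings_hd_not_Min:
  assumes "finite S" "card S \<ge> 2" "card S = Suc (count_list d North)"
  shows "\<exists>s\<in>S. card {xs \<in> labellings (North # d) S. hd xs \<noteq> Min S} =
    (if d \<noteq> [] \<and> hd d = North then card {xs \<in> labellings d (S - {s}). hd xs \<noteq> Min (S - {s})}
     else card (labellings d (S - {s})))"
proof -
  define m where "m = Min S"
  define s where "s = Min (S - {m})"
  have ne: "S \<noteq> {}" using assms by auto
  have m: "m \<in> S" "\<And>y. y \<in> S \<Longrightarrow> m \<le> y" using assms(1) ne by (auto simp: m_def)
  have "card (S - {m}) \<noteq> 0" using m assms by simp
  then have ne': "S - {m} \<noteq> {}" by force
  have s: "s \<in> S" "s \<noteq> m" "\<And>y. y \<in> S \<Longrightarrow> y \<noteq> m \<Longrightarrow> s \<le> y"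
    using assms(1) ne' Min_in[of "S - {m}"] by (auto simp: s_def)
  have ms: "m < s" using m(2)[OF s(1)] s(2) by simp
  \<comment> \<open>Removing \<open>s\<close> keeps the minimum, so "letter 1" at the next step
    again means "different from \<open>m\<close>".\<close>
  have Min': "Min (S - {s}) = m"
    using assms(1) m ms by (intro Min_eqI) auto
  have below_s: "{y \<in> S - {s}. y < s} = {m}" using s m ms by force
  \<comment> \<open>Any other non-minimal first label would have both \<open>m\<close> and
    \<open>s\<close> as smaller later entries.\<close>
  have x_is_s: "x = s" if "x \<in> S" "x \<noteq> m" "card {y \<in> S - {x}. y < x} \<le> 1" for x
  proof (rule ccontr)
    assume "x \<noteq> s"
    then have "{m, s} \<subseteq> {y \<in> S - {x}. y < x}"
      using that s(1,3) m(1) ms by (force simp: order.strict_iff_order)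
    then have "card {m, s} \<le> card {y \<in> S - {x}. y < x}"
      using assms(1) by (intro card_mono) auto
    then show False using that(3) s(2) by simp
  qed
  \<comment> \<open>Every element of \<open>S\<close> other than \<open>m\<close> and
    \<open>s\<close> exceeds \<open>s\<close>, and \<open>hd ys\<close> cannot be
    \<open>s\<close>.\<close>
  have ys_hd: "s < hd ys \<longleftrightarrow> hd ys \<noteq> m"
    if "ys \<in> labellings d (S - {s})" "d \<noteq> []" "hd d = North" for ys
  proof -
    have "ys \<noteq> []" "set ys = S - {s}"
      using that increasing_along_nonempty by (auto simp: labellings_def)
    then have "hd ys \<in> S - {s}" using hd_in_set by blast
    then have "hd ys \<in> S" "hd ys \<noteq> s" by auto
    then show ?thesis using s(3)[of "hd ys"] ms by (metis order.strict_iff_order order.asym)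
  qed
  have eq: "{xs \<in> labellings (North # d) S. hd xs \<noteq> m} =
     Cons s ` {ys \<in> labellings d (S - {s}). d \<noteq> [] \<and> hd d = North \<longrightarrow> hd ys \<noteq> m}"
    (is "?L = ?R")
  proof
    show "?L \<subseteq> ?R"
    proof
      fix xs assume xs: "xs \<in> ?L"
      then obtain x ys where c: "xs = x # ys" by (cases xs) (auto simp: labellings_def)
      with xs have x: "set ys = S - {x}" "x \<in> S" "x \<noteq> m" by (auto simp: labellings_def)
      then have "x = s" using xs c x_is_s[of x] by (auto simp: labellings_def)
      moreover have "ys \<in> labellings d (S - {x})" using xs c x by (auto simp: labellings_def)
      moreover have "d \<noteq> [] \<and> hd d = North \<longrightarrow> x < hd ys"
        using xs c by (auto simp: labellings_def)
      ultimately show "xs \<in> ?R" using ys_hd c by auto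
    qed
    show "?R \<subseteq> ?L"
    proof
      fix xs assume "xs \<in> ?R"
      then obtain ys where xs: "xs = s # ys" and ys: "ys \<in> labellings d (S - {s})"
        and h: "d \<noteq> [] \<and> hd d = North \<longrightarrow> hd ys \<noteq> m" by blast
      have st: "set ys = S - {s}" using ys by (simp add: labellings_def)
      have "card {y \<in> set ys. y < s} \<le> 1" unfolding st below_s by simp
      then show "xs \<in> ?L" using ys h ys_hd[OF ys] s(1,2)
        by (auto simp: xs labellings_def)
    qed
  qed
  have "card {xs \<in> labellings (North # d) S. hd xs \<noteq> m} =
     card {ys \<in> labellings d (S - {s}). d \<noteq> [] \<and> hd d = North \<longrightarrow> hd ys \<noteq> m}"
    unfolding eq by (rule card_image) simp
  then show ?thesis using s(1) by (intro bexI[of _ s]) (auto simp: Min' m_def)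
qed

text \<open>The second conjunct strengthens the induction: it counts the labellings starting with a 1.\<close>

lemma card_labellings_aux:
  assumes "finite S" "card S = count_list d North"
  shows "card (labellings d S) = run_weight (north_runs d) \<and>
    (d \<noteq> [] \<and> hd d = North \<longrightarrow> card {xs \<in> labellings d S. hd xs \<noteq> Min S} =
       (if tl (north_runs d) = [] then 0 else run_weight (tl (north_runs d))))"
  using assms
proof (induction d arbitrary: S)
  case Nil
  then have "labellings [] S = {[]}" by (auto simp: labellings_def)
  then show ?case by simp
next
  case (Cons a d)
  show ?case
  proof (cases a)
    case East
    then show ?thesis using Cons by (auto simp: labellings_def)
  next
    case North
    have cS: "card S = Suc (count_list d North)" using Cons.prems North by simp
    then have ne: "S \<noteq> {}" by auto
    \<comment> \<open>The counts depend on the label set only through its size, so any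
      \<open>x\<close> may be removed. Hence the mere existence of \<open>s\<close> in
      \<open>card_labellings_hd_not_Min\<close> suffices.\<close>
    have IH: "card (labellings d (S - {x})) = run_weight (north_runs d)"
      "d \<noteq> [] \<and> hd d = North \<longrightarrow> card {xs \<in> labellings d (S - {x}). hd xs \<noteq> Min (S - {x})} =
       (if tl (north_runs d) = [] then 0 else run_weight (tl (north_runs d)))"
      if "x \<in> S" for x
      using Cons.IH[of "S - {x}"] that cS Cons.prems(1) by simp_all
    have split: "card (labellings (North # d) S) = run_weight (north_runs d) +
        card {xs \<in> labellings (North # d) S. hd xs \<noteq> Min S}"
      using labellings_North_split[OF Cons.prems(1) ne, of d] IH(1)[of "Min S"] Cons.prems(1) ne
      by simp
    show ?thesis
    proof (cases "d \<noteq> [] \<and> hd d = North")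
      case True
      then obtain d' where d: "d = North # d'" by (cases d) auto
      obtain w ws where runs: "north_runs d = w # ws" "north_runs (North # d) = Suc w # ws"
        by (simp add: d)
      have "card S \<ge> 2" using cS d by simp
      from card_labellings_hd_not_Min[OF Cons.prems(1) this cS] IH(2) True runs
      have "card {xs \<in> labellings (North # d) S. hd xs \<noteq> Min S} =
          (if ws = [] then 0 else run_weight ws)" by auto
      \<comment> \<open>Let R be \<open>run_weight ws\<close>. For nonempty \<open>ws\<close>, first
        letter 0 contributes (w + 1) * R and first letter 1 contributes R, in total (w + 2) * R, the
        weight for a first run of length \<open>Suc w\<close>. For empty \<open>ws\<close> the sum
        is 1 + 0.\<close>
      then show ?thesis using split runs North by (auto simp: run_weight_Cons)
    next
      case False
      then have tw: "takeWhile (\<lambda>s. s = North) d = []" "dropWhile (\<lambda>s. s = North) d = d"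
        by (cases d; auto)+
      then have runs: "north_runs (North # d) = 1 # north_runs d" by simp
      show ?thesis
      proof (cases "north_runs d = []")
        case True
        \<comment> \<open>No north step remains, so there is a single label and its letter can only
          be 0.\<close>
        then have "card S = 1" using cS by (simp add: north_runs_eq_Nil_iff)
        then obtain x where "S = {x}" by (auto simp: card_1_singleton_iff)
        have "hd xs = Min S" if "xs \<in> labellings (North # d) S" for xs
        proof -
          have "xs \<noteq> []" "set xs = {x}" using that \<open>S = {x}\<close> by (auto simp: labellings_def)
          then have "hd xs = x" using hd_in_set by blast
          then show ?thesis using \<open>S = {x}\<close> by simp
        qed
        then have "{xs \<in> labellings (North # d) S. hd xs \<noteq> Min S} = {}" by blast
        then have "card {xs \<in> labellings (North # d) S. hd xs \<noteq> Min S} = 0"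
          by (simp only: card.empty)
        then show ?thesis using split runs North True by simp
      next
        case ws: False
        then have "card S \<ge> 2" using cS by (simp add: north_runs_eq_Nil_iff)
        from card_labellings_hd_not_Min[OF Cons.prems(1) this cS] IH(1) False
        have "card {xs \<in> labellings (North # d) S. hd xs \<noteq> Min S} = run_weight (north_runs d)"
          by auto
        \<comment> \<open>A run of length 1 before further runs has a free letter: both choices
          contribute \<open>run_weight (north_runs d)\<close>, which gives the factor 1 + 1.\<close>
        then show ?thesis using split runs North ws by (simp add: run_weight_Cons)
      qed
    qed
  qed
qed

lemma card_labellings:
  "finite S \<Longrightarrow> card S = count_list d North \<Longrightarrow>
   card (labellings d S) = run_weight (north_runs d)"
  using card_labellings_aux by blast

section \<open>Avoidance of 312 and 321 through smaller later entries\<close>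

text \<open>Triples with \<open>i = 0\<close> say that the head has two smaller later entries; all
  other triples lie in the tail. Distinctness lets two positions be counted as two values.\<close>

lemma avoiding_iff:
  assumes "distinct xs"
  shows "avoiding xs \<longleftrightarrow>
    \<not> (\<exists>i j k. i < j \<and> j < k \<and> k < length xs \<and> xs ! j < xs ! i \<and> xs ! k < xs ! i)"
  using assms
proof (induction xs)
  case (Cons x xs)
  have "card {y \<in> set xs. y < x} \<le> 1 \<longleftrightarrow>
      \<not> (\<exists>j k. j < k \<and> k < length xs \<and> xs ! j < x \<and> xs ! k < x)" (is "?A \<longleftrightarrow> \<not> ?B")
  proof
    assume ?A
    then have uniq: "\<And>y z. y \<in> set xs \<Longrightarrow> z \<in> set xs \<Longrightarrow> y < x \<Longrightarrow> z < x \<Longrightarrow> y = z"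
      by (auto simp: card_le_Suc0_iff_eq)
    show "\<not> ?B"
    proof
      assume ?B
      then obtain j k where jk: "j < k" "k < length xs" "xs ! j < x" "xs ! k < x" by blast
      then have "xs ! j = xs ! k" using uniq by simp
      then show False using jk Cons.prems by (simp add: nth_eq_iff_index_eq)
    qed
  next
    assume B: "\<not> ?B"
    have "y = z" if "y \<in> set xs" "z \<in> set xs" "y < x" "z < x" for y z
    proof -
      from that obtain i j where "y = xs ! i" "z = xs ! j" "i < length xs" "j < length xs"
        by (auto simp: in_set_conv_nth)
      \<comment> \<open>Two different positions, taken in increasing order, would witness
        \<open>?B\<close>.\<close>
      then show ?thesis using B that by (metis linorder_less_linear)
    qed
    then show ?A by (auto simp: card_le_Suc0_iff_eq)
  qed
  moreover have "(\<exists>i j k. i < j \<and> j < k \<and> k < length (x # xs) \<and>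
      (x # xs) ! j < (x # xs) ! i \<and> (x # xs) ! k < (x # xs) ! i) \<longleftrightarrow>
      ?B \<or> (\<exists>i j k. i < j \<and> j < k \<and> k < length xs \<and> xs ! j < xs ! i \<and> xs ! k < xs ! i)"
    (is "?C \<longleftrightarrow> ?B \<or> ?D")
  proof
    assume ?C
    then obtain i j k where ijk: "i < j" "j < k" "k < length (x # xs)"
      "(x # xs) ! j < (x # xs) ! i" "(x # xs) ! k < (x # xs) ! i" by blast
    then obtain j' k' where "j = Suc j'" "k = Suc k'" by (metis less_imp_Suc_add)
    with ijk show "?B \<or> ?D" by (cases i) auto
  next
    assume "?B \<or> ?D"
    then show ?C
    proof
      assume ?B
      then obtain j k where "j < k" "k < length xs" "xs ! j < x" "xs ! k < x" by blast
      then show ?C by (intro exI[of _ 0] exI[of _ "Suc j"] exI[of _ "Suc k"]) simp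
    next
      assume ?D
      then obtain i j k where "i < j" "j < k" "k < length xs" "xs ! j < xs ! i" "xs ! k < xs ! i"
        by blast
      then show ?C by (intro exI[of _ "Suc i"] exI[of _ "Suc j"] exI[of _ "Suc k"]) simp
    qed
  qed
  ultimately show ?case using Cons by simp
qed simp

text \<open>A strictly monotone map on \<open>{0, 1, 2}\<close> amounts to three increasing indices.
  Pairing each index with its pattern entry packs the nine comparisons into quantifiers over
  explicit finite sets, which simplification can expand.\<close>

lemma contains_pattern_3_iff:
  "contains_pattern xs [a, b, c] \<longleftrightarrow>
     (\<exists>i j k. i < j \<and> j < k \<and> k < length xs \<and>
       (\<forall>(u, p) \<in> {(i, a), (j, b), (k, c)}. \<forall>(v, q) \<in> {(i, a), (j, b), (k, c)}.
          xs ! u \<le> xs ! v \<longleftrightarrow> p \<le> q))"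
  (is "_ \<longleftrightarrow> (\<exists>i j k. ?P i j k)")
proof
  have dom: "{..<length [a, b, c]} = {0, 1, 2}" by auto
  have all3: "(\<forall>u<length [a, b, c]. Q u) \<longleftrightarrow> Q 0 \<and> Q 1 \<and> Q 2" for Q
    by (auto simp: numeral_3_eq_3 numeral_2_eq_2 less_Suc_eq)
  {
    assume "contains_pattern xs [a, b, c]"
    then obtain f where "strict_mono_on {0, 1, 2::nat} f" "f ` {0, 1, 2} \<subseteq> {..<length xs}"
      "\<forall>u<length [a, b, c]. \<forall>v<length [a, b, c].
        xs ! f u \<le> xs ! f v \<longleftrightarrow> [a, b, c] ! u \<le> [a, b, c] ! v"
      unfolding contains_pattern_def dom by blast
    then have "?P (f 0) (f 1) (f 2)"
      unfolding all3 by (simp add: strict_mono_on_def)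
    then show "\<exists>i j k. ?P i j k" by blast
  next
    assume "\<exists>i j k. ?P i j k"
    then obtain i j k where P: "?P i j k" by blast
    define f where "f = (!) [i, j, k]"
    have "strict_mono_on {0, 1, 2::nat} f" using P by (auto simp: strict_mono_on_def f_def)
    moreover have "f ` {0, 1, 2} \<subseteq> {..<length xs}" using P by (auto simp: f_def)
    moreover have "\<forall>u<length [a, b, c]. \<forall>v<length [a, b, c].
        xs ! f u \<le> xs ! f v \<longleftrightarrow> [a, b, c] ! u \<le> [a, b, c] ! v"
      unfolding all3 using P by (simp add: f_def)
    ultimately show "contains_pattern xs [a, b, c]"
      unfolding contains_pattern_def dom by blast
  }
qed

text \<open>The two patterns are the two possible orders of the last two entries below the first;
  distinctness rules out a tie.\<close>

lemma avoids_312_321_iff: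
  assumes "distinct xs"
  shows "(\<forall>\<rho>\<in>{[3, 1, 2], [3, 2, 1]}. \<not> contains_pattern xs \<rho>) \<longleftrightarrow> avoiding xs"
proof -
  have "contains_pattern xs [3, 1, 2] \<or> contains_pattern xs [3, 2, 1] \<longleftrightarrow>
    (\<exists>i j k. i < j \<and> j < k \<and> k < length xs \<and> xs ! j < xs ! i \<and> xs ! k < xs ! i)" (is "?A \<longleftrightarrow> ?B")
  proof
    assume ?A
    then show ?B
      unfolding contains_pattern_3_iff by (elim disjE exE; intro exI) auto
  next
    assume ?B
    then obtain i j k where ijk: "i < j" "j < k" "k < length xs" "xs ! j < xs ! i" "xs ! k < xs ! i"
      by blast
    then have "xs ! j \<noteq> xs ! k" using assms by (simp add: nth_eq_iff_index_eq)
    then consider "xs ! j < xs ! k" | "xs ! k < xs ! j" by linarith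
    then show ?A
    proof cases
      case 1
      then have "contains_pattern xs [3, 1, 2]" unfolding contains_pattern_3_iff
        using ijk by (intro exI[of _ i] exI[of _ j] exI[of _ k]) auto
      then show ?thesis ..
    next
      case 2
      then have "contains_pattern xs [3, 2, 1]" unfolding contains_pattern_3_iff
        using ijk by (intro exI[of _ i] exI[of _ j] exI[of _ k]) auto
      then show ?thesis ..
    qed
  qed
  then show ?thesis unfolding avoiding_iff[OF assms] by blast
qed

section \<open>Labelling functions versus lists of labels\<close>

text \<open>Mapping \<open>l\<close> over this list gives
  \<open>parking_perm (d, l)\<close>.\<close>

abbreviation north_list :: "step list \<Rightarrow> nat list" where
  "north_list d \<equiv> filter (\<lambda>i. d ! i = North) [0..<length d]"

lemma set_north_list: "set (north_list d) = north_positions d"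
  by (auto simp: north_positions_def)

lemma north_list_Cons:
  "north_list (a # d) = (if a = North then [0] else []) @ map Suc (north_list d)"
proof -
  have "[0..<length (a # d)] = 0 # map Suc [0..<length d]"
    by (simp add: upt_conv_Cons map_Suc_upt del: upt_Suc)
  then show ?thesis by (simp add: filter_map o_def)
qed

lemma length_north_list: "length (north_list d) = count_list d North"
proof (induction d)
  case (Cons a d)
  then show ?case unfolding north_list_Cons by simp
qed simp

lemma hd_north_list: "d \<noteq> [] \<Longrightarrow> hd d = North \<Longrightarrow> north_list d \<noteq> [] \<and> hd (north_list d) = 0"
  by (cases d) (simp_all only: north_list_Cons list.sel if_True append_Cons list.distinct simp_thms)

text \<open>Induction on the path with \<open>l\<close> arbitrary: a new first step shifts all
  positions by one, so the tail is labelled by \<open>l \<circ> Suc\<close>.\<close>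

lemma increasing_along_map_iff:
  "increasing_along d (map l (north_list d)) \<longleftrightarrow>
    (\<forall>i. i \<in> north_positions d \<and> Suc i \<in> north_positions d \<longrightarrow> l i < l (Suc i))"
proof (induction d arbitrary: l)
  case Nil
  then show ?case by (simp add: north_positions_def)
next
  case (Cons a d)
  have pos: "Suc i \<in> north_positions (a # d) \<longleftrightarrow> i \<in> north_positions d"
    "0 \<in> north_positions (a # d) \<longleftrightarrow> a = North"
    "0 \<in> north_positions d \<longleftrightarrow> d \<noteq> [] \<and> hd d = North" for i
    by (auto simp: north_positions_def hd_conv_nth)
  have all: "(\<forall>i. Q i) \<longleftrightarrow> Q 0 \<and> (\<forall>i. Q (Suc i))" for Q :: "nat \<Rightarrow> bool"
  proof
    assume "Q 0 \<and> (\<forall>i. Q (Suc i))"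
    then have "Q i" for i by (cases i) auto
    then show "\<forall>i. Q i" by blast
  qed blast
  have IH: "increasing_along d (map (l \<circ> Suc) (north_list d)) \<longleftrightarrow>
      (\<forall>i. i \<in> north_positions d \<and> Suc i \<in> north_positions d \<longrightarrow> l (Suc i) < l (Suc (Suc i)))"
    using Cons.IH[of "l \<circ> Suc"] by (simp add: o_def)
  \<comment> \<open>Position 0 contributes the comparison across the first two steps, the successor
    positions those inside \<open>d\<close>.\<close>
  have split: "(\<forall>i. i \<in> north_positions (a # d) \<and> Suc i \<in> north_positions (a # d) \<longrightarrow>
        l i < l (Suc i)) \<longleftrightarrow>
      (a = North \<and> d \<noteq> [] \<and> hd d = North \<longrightarrow> l 0 < l (Suc 0)) \<and>
      (\<forall>i. i \<in> north_positions d \<and> Suc i \<in> north_positions d \<longrightarrow> l (Suc i) < l (Suc (Suc i)))"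
    by (subst all) (simp only: pos)
  have "increasing_along (a # d) (map l (north_list (a # d))) \<longleftrightarrow>
      increasing_along d (map (l \<circ> Suc) (north_list d)) \<and>
      (a = North \<and> d \<noteq> [] \<and> hd d = North \<longrightarrow> l 0 < hd (map (l \<circ> Suc) (north_list d)))"
    unfolding north_list_Cons by (cases a) simp_all
  also have "\<dots> \<longleftrightarrow> increasing_along d (map (l \<circ> Suc) (north_list d)) \<and>
      (a = North \<and> d \<noteq> [] \<and> hd d = North \<longrightarrow> l 0 < l (Suc 0))"
    using hd_north_list[of d] by (auto simp: hd_map)
  finally show ?case unfolding IH split by blast
qed

text \<open>An extensional labelling is determined by its values at the north positions, and reading
  them in path order loses nothing. Bijectivity onto \<open>S\<close> becomes distinctness together
  with the right set of entries.\<close>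

lemma bij_betw_labellings:
  "bij_betw (\<lambda>l. map l (north_list d))
     {l \<in> extensional (north_positions d). bij_betw l (north_positions d) S \<and>
        (\<forall>i. i \<in> north_positions d \<and> Suc i \<in> north_positions d \<longrightarrow> l i < l (Suc i)) \<and>
        avoiding (map l (north_list d))}
     (labellings d S)" (is "bij_betw ?f ?A _")
proof -
  have mem: "?f l \<in> labellings d S \<longleftrightarrow> l \<in> ?A" if "l \<in> extensional (north_positions d)" for l
  proof -
    have "distinct (?f l) \<and> set (?f l) = S \<longleftrightarrow> bij_betw l (north_positions d) S"
      unfolding bij_betw_def distinct_map set_map set_north_list by simp
    then show ?thesis using that increasing_along_map_iff[of d l]
      unfolding labellings_def by blast
  qed
  have "inj_on ?f ?A"
  proof (rule inj_onI)
    fix l l' assume "l \<in> ?A" "l' \<in> ?A" "?f l = ?f l'"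
    then have "l i = l' i" if "i \<in> north_positions d" for i
      using that unfolding map_eq_conv set_north_list by blast
    then show "l = l'" using \<open>l \<in> ?A\<close> \<open>l' \<in> ?A\<close> by (blast intro: extensionalityI)
  qed
  moreover have "?f ` ?A = labellings d S"
  proof
    show "?f ` ?A \<subseteq> labellings d S" using mem by blast
    show "labellings d S \<subseteq> ?f ` ?A"
    proof
      fix xs assume xs: "xs \<in> labellings d S"
      then have len: "length xs = length (north_list d)"
        unfolding length_north_list by (auto simp: labellings_def dest: length_increasing_along)
      \<comment> \<open>The preimage looks up each north position in the list of labels. The lengths
        agree, so every position finds its label; \<open>restrict\<close> makes the function
        extensional.\<close>
      define l where "l = restrict (the \<circ> map_of (zip (north_list d) xs)) (north_positions d)"
      have "?f l = xs"
      proof (rule nth_equalityI)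
        fix i assume "i < length (?f l)"
        then have i: "i < length (north_list d)" by simp
        then have "north_list d ! i \<in> north_positions d"
          using nth_mem set_north_list by blast
        then have "l (north_list d ! i) = xs ! i"
          using i len by (simp add: l_def map_of_zip_nth)
        then show "?f l ! i = xs ! i" using i by simp
      qed (simp add: len)
      moreover have "l \<in> extensional (north_positions d)" by (simp add: l_def)
      ultimately show "xs \<in> ?f ` ?A" using mem xs by blast
    qed
  qed
  ultimately show ?thesis by (simp add: bij_betw_def)
qed

section \<open>Summation over Dyck paths\<close>

theorem theorem28:
  fixes n :: nat
  assumes "n \<ge> 1"
  shows "pf n {[3, 1, 2], [3, 2, 1]} =
    (\<Sum>d\<in>dyck_paths n. \<Prod>i<length (north_runs d) - 1. (north_runs d ! i + 1))"
proof -
  let ?L = "\<lambda>d. {l \<in> extensional (north_positions d). bij_betw l (north_positions d) {1..n} \<and>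
        (\<forall>i. i \<in> north_positions d \<and> Suc i \<in> north_positions d \<longrightarrow> l i < l (Suc i)) \<and>
        avoiding (map l (north_list d))}"
  have avoid: "(\<forall>\<rho>\<in>{[3, 1, 2], [3, 2, 1]}. \<not> contains_pattern (parking_perm (d, l)) \<rho>) \<longleftrightarrow>
      avoiding (map l (north_list d))" if "bij_betw l (north_positions d) {1..n}" for d l
  proof -
    have "distinct (map l (north_list d))"
      using that unfolding bij_betw_def distinct_map set_north_list by simp
    from avoids_312_321_iff[OF this] show ?thesis by (simp add: parking_perm_def)
  qed
  \<comment> \<open>The avoiding parking functions are fibred over their paths, with fibres
    \<open>?L d\<close>, so their number is a sum over paths.\<close>
  have "{p \<in> parking_functions n.
      \<forall>\<rho>\<in>{[3, 1, 2], [3, 2, 1]}. \<not> contains_pattern (parking_perm p) \<rho>} = Sigma (dyck_paths n) ?L"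
    using avoid unfolding parking_functions_def by blast
  then have "pf n {[3, 1, 2], [3, 2, 1]} = card (Sigma (dyck_paths n) ?L)"
    by (simp add: pf_def)
  also have "\<dots> = (\<Sum>d\<in>dyck_paths n. card (?L d))"
  proof (rule card_SigmaI[OF finite_dyck_paths], intro ballI)
    fix d
    show "finite (?L d)"
      \<comment> \<open>Finiteness of the set of functions is transferred from the set of
        lists.\<close>
      using bij_betw_finite[OF bij_betw_labellings[of d "{1..n}"]] finite_labellings by blast
  qed
  also have "\<dots> = (\<Sum>d\<in>dyck_paths n. run_weight (north_runs d))"
  proof (rule sum.cong[OF refl])
    fix d assume "d \<in> dyck_paths n"
    then have "card {1..n} = count_list d North" by (simp add: dyck_paths_def)
    then show "card (?L d) = run_weight (north_runs d)"
      using bij_betw_same_card[OF bij_betw_labellings[of d "{1..n}"]] card_labellings[of "{1..n}" d]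
      by simp
  qed
  finally show ?thesis by (simp add: run_weight_eq_prod)
qed

end
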